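(* Let $(G=(U\cup V,E),C,\mathrm{col},\ell)$ be an instance of \textsc{MoV Fair Matching} in which $G$ is a complete bipartite graph, with $n=|U|$, $k=|V|$, $C=\{c_1,\dots,c_{|C|}\}$ ordered so that $|U_{c_i}|\ge|U_{c_{i+1}}|$ for all $i\in[1,|C|-1]$, and with the convention $|U_{c_i}|:=0$ for $i>|C|$. Then the instance is a yes-instance if and only if $|U_{c_1}|\le \ell k+\sum_{i\in[k]}|U_{c_{i+1}}|$. With the non-emptiness constraint, the instance is a yes-instance if and only if it satisfies $|U_{c_1}|\le \ell k+\sum_{i\in[k]}|U_{c_{i+1}}|$ and additionally either ($\ell>0$ and $n\ge k$) or ($\ell=0$ and $n\ge 2k$).
   Context: For a bipartite graph $G=(U\cup V,E)$ with left side $U$ and right side $V$, a vertex $w$ and $M\subseteq E$, let $M(w)=\{w' \mid \{w,w'\}\in M\}$. A many-to-one matching is a set $M\subseteq E$ with $|M(u)|\le 1$ for every $u\in U$; it is left-perfect if $|M(u)|=1$ for every $u\in U$. Let $C$ be a finite set of colors and $\mathrm{col}\colon U\to C$; for $U'\subseteq U$ and $c\in C$ let $U'_c=\{u\in U'\mid \mathrm{col}(u)=c\}$. $\mathrm{MoV}(U')$ is the largest value minus the second largest value in the list $(|U'_c|)_{c\in C}$ (counted with multiplicity; absent colors count $0$). For an integer $\ell\ge0$, $U'$ is $\ell$-fair if $\mathrm{MoV}(U')\le\ell$, and $M$ is $\ell$-fair if $M(v)$ is $\ell$-fair for every $v\in V$. An instance $(G,C,\mathrm{col},\ell)$ of \textsc{MoV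 Fair Matching} is a yes-instance if there is an $\ell$-fair left-perfect many-to-one matching in $G$; with the non-emptiness constraint one additionally requires $M(v)\neq\emptyset$ for every $v\in V$. $[k]=\{1,\dots,k\}$. *)

theory Defs
  imports "HOL-Library.Multiset" "HOL-Library.More_List"
begin

definition bipartite_edges :: "'a set \<Rightarrow> 'a set \<Rightarrow> 'a set set" where
  "bipartite_edges U V = {{u, v} |u v. u \<in> U \<and> v \<in> V}"

definition bipartite_graph :: "'a set \<Rightarrow> 'a set \<Rightarrow> 'a set set \<Rightarrow> bool" where
  "bipartite_graph U V E \<longleftrightarrow>
     finite U \<and> finite V \<and> U \<inter> V = {} \<and> E \<subseteq> bipartite_edges U V"

definition complete_bipartite_graph :: "'a set \<Rightarrow> 'a set \<Rightarrow> 'a set set \<Rightarrow> bool" where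
  "complete_bipartite_graph U V E \<longleftrightarrow> bipartite_graph U V E \<and> E = bipartite_edges U V"

definition partners :: "'a set set \<Rightarrow> 'a \<Rightarrow> 'a set" where
  "partners M w = {w'. {w, w'} \<in> M}"

definition many_to_one_matching :: "'a set \<Rightarrow> 'a set set \<Rightarrow> 'a set set \<Rightarrow> bool" where
  "many_to_one_matching U E M \<longleftrightarrow> M \<subseteq> E \<and> (\<forall>u\<in>U. card (partners M u) \<le> 1)"

definition left_perfect :: "'a set \<Rightarrow> 'a set set \<Rightarrow> bool" where
  "left_perfect U M \<longleftrightarrow> (\<forall>u\<in>U. card (partners M u) = 1)"

definition color_class :: "('a \<Rightarrow> 'c) \<Rightarrow> 'a set \<Rightarrow> 'c \<Rightarrow> 'a set" where
  "color_class col U' c = {u \<in> U'. col u = c}"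

definition color_counts :: "'c set \<Rightarrow> ('a \<Rightarrow> 'c) \<Rightarrow> 'a set \<Rightarrow> nat list" where
  "color_counts C col U' =
     rev (sorted_list_of_multiset {#card (color_class col U' c). c \<in># mset_set C#})"

text \<open>
  The counts are in descending order, so the subtraction on \<^typ>\<open>nat\<close> does not truncate.
  Missing entries count as 0: if there is only one color, the second largest value is 0,
  in line with the convention that the color classes beyond the last color have size 0.
\<close>

definition MoV :: "'c set \<Rightarrow> ('a \<Rightarrow> 'c) \<Rightarrow> 'a set \<Rightarrow> nat" where
  "MoV C col U' =
     nth_default 0 (color_counts C col U') 0 - nth_default 0 (color_counts C col U') 1"

definition fair_set :: "'c set \<Rightarrow> ('a \<Rightarrow> 'c) \<Rightarrow> nat \<Rightarrow> 'a set \<Rightarrow> bool" where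
  "fair_set C col l U' \<longleftrightarrow> MoV C col U' \<le> l"

definition fair_matching :: "'a set \<Rightarrow> 'c set \<Rightarrow> ('a \<Rightarrow> 'c) \<Rightarrow> nat \<Rightarrow> 'a set set \<Rightarrow> bool" where
  "fair_matching V C col l M \<longleftrightarrow> (\<forall>v\<in>V. fair_set C col l (partners M v))"

definition MoV_instance ::
  "'a set \<Rightarrow> 'a set \<Rightarrow> 'a set set \<Rightarrow> 'c set \<Rightarrow> ('a \<Rightarrow> 'c) \<Rightarrow> nat \<Rightarrow> bool" where
  "MoV_instance U V E C col l \<longleftrightarrow> bipartite_graph U V E \<and> finite C \<and> col ` U \<subseteq> C"

definition yes_instance ::
  "'a set \<Rightarrow> 'a set \<Rightarrow> 'a set set \<Rightarrow> 'c set \<Rightarrow> ('a \<Rightarrow> 'c) \<Rightarrow> nat \<Rightarrow> bool" where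
  "yes_instance U V E C col l \<longleftrightarrow>
     (\<exists>M. many_to_one_matching U E M \<and> left_perfect U M \<and> fair_matching V C col l M)"

definition yes_instance_nonempty ::
  "'a set \<Rightarrow> 'a set \<Rightarrow> 'a set set \<Rightarrow> 'c set \<Rightarrow> ('a \<Rightarrow> 'c) \<Rightarrow> nat \<Rightarrow> bool" where
  "yes_instance_nonempty U V E C col l \<longleftrightarrow>
     (\<exists>M. many_to_one_matching U E M \<and> left_perfect U M \<and> fair_matching V C col l M \<and>
          (\<forall>v\<in>V. partners M v \<noteq> {}))"

definition class_size ::
  "'a set \<Rightarrow> 'c set \<Rightarrow> ('a \<Rightarrow> 'c) \<Rightarrow> (nat \<Rightarrow> 'c) \<Rightarrow> nat \<Rightarrow> nat" where
  "class_size U C col c i = (if i \<le> card C then card (color_class col U (c i)) else 0)"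

end

theory Submission imports Defs begin

text \<open>
  Call a vector of color counts \<open>k\<close>-covered if every color is at most \<open>l * k\<close> plus the total of at most
  \<open>k\<close> other colors. A set is \<open>l\<close>-fair iff its counts are 1-covered, and the inequality of the theorem
  says that \<open>U\<close> is \<open>k\<close>-covered. Sums of \<open>j\<close>- and \<open>k\<close>-covered vectors are \<open>(j + k)\<close>-covered, which
  gives necessity. For sufficiency, a \<open>(k + 1)\<close>-covered vector splits into a 1-covered and a
  \<open>k\<close>-covered one. If it is not yet \<open>k\<close>-covered, some color \<open>c\<close> exceeds \<open>l * k\<close> plus the best \<open>k\<close> other
  colors; split off exactly that excess, compensated by a further color. If it is already
  \<open>k\<close>-covered, the empty part will do, or, when nonempty parts are wanted, one element of the largest
  color (\<open>l > 0\<close>) or a pair of elements of different colors (\<open>l = 0\<close>).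
\<close>

section \<open>Covered count vectors\<close>

text \<open>Every color is constrained, not only a largest one, so no ordering of the colors enters.
  The bound \<open>card D \<le> k\<close> in place of equality lets \<open>k\<close> exceed the
  number of other colors.\<close>

definition covered :: "'c set \<Rightarrow> nat \<Rightarrow> nat \<Rightarrow> ('c \<Rightarrow> nat) \<Rightarrow> bool" where
  "covered C l k f \<longleftrightarrow> (\<forall>c\<in>C. \<exists>D\<subseteq>C - {c}. card D \<le> k \<and> f c \<le> l * k + sum f D)"

abbreviation counts :: "('a \<Rightarrow> 'c) \<Rightarrow> 'a set \<Rightarrow> 'c \<Rightarrow> nat" where
  "counts col W \<equiv> \<lambda>c. card (color_class col W c)"

text \<open>The union of the two witness sets works: overlap only lowers its cardinality, and
  enlarging an index set never lowers a sum of naturals.\<close>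

lemma covered_add:
  assumes "finite C" "covered C l j f" "covered C l k g"
  shows "covered C l (j + k) (\<lambda>c. f c + g c)"
  unfolding covered_def
proof
  fix c assume "c \<in> C"
  then obtain A B where A: "A \<subseteq> C - {c}" "card A \<le> j" "f c \<le> l * j + sum f A"
    and B: "B \<subseteq> C - {c}" "card B \<le> k" "g c \<le> l * k + sum g B"
    using assms unfolding covered_def by meson
  have "finite (A \<union> B)" using A B assms(1) by (meson finite_Diff finite_UnI finite_subset)
  then have "sum f A \<le> sum f (A \<union> B)" "sum g B \<le> sum g (A \<union> B)"
    by (auto intro: sum_mono2)
  moreover have "card (A \<union> B) \<le> j + k" using card_Un_le[of A B] A B by linarith
  ultimately show "\<exists>D\<subseteq>C - {c}. card D \<le> j + k \<and> f c + g c \<le> l * (j + k) + (\<Sum>x\<in>D. f x + g x)"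
    using A B by (intro exI[of _ "A \<union> B"]) (auto simp: sum.distrib algebra_simps)
qed

lemma covered_sum:
  assumes "finite C" "finite V" "\<And>v. v \<in> V \<Longrightarrow> covered C l 1 (g v)"
  shows "covered C l (card V) (\<lambda>c. \<Sum>v\<in>V. g v c)"
  using assms(2,3)
proof (induction V rule: finite_induct)
  case empty
  then show ?case unfolding covered_def by (auto intro!: exI[of _ "{}"])
next
  case (insert v V)
  then show ?case using covered_add[OF assms(1), of l 1 "g v" "card V" "\<lambda>c. \<Sum>v\<in>V. g v c"] by simp
qed

text \<open>One slack \<open>l\<close> and one other color are within budget as soon as
  \<open>k \<ge> 1\<close>. Besides the case \<open>k = 1\<close>, this yields simple coverings of
  remainders for arbitrary \<open>k\<close>.\<close>

lemma coveredI_pointwise: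
  assumes "k \<ge> 1" "\<And>c. c \<in> C \<Longrightarrow> f c \<le> l \<or> (\<exists>d\<in>C - {c}. f c \<le> l + f d)"
  shows "covered C l k f"
  unfolding covered_def
proof
  fix c assume "c \<in> C"
  have l: "l \<le> l * k" using assms(1) by simp
  from assms(2)[OF \<open>c \<in> C\<close>] show "\<exists>D\<subseteq>C - {c}. card D \<le> k \<and> f c \<le> l * k + sum f D"
  proof
    assume "f c \<le> l"
    then have "f c \<le> l * k" using l by (rule order_trans)
    then show ?thesis by (intro exI[of _ "{}"]) auto
  next
    assume "\<exists>d\<in>C - {c}. f c \<le> l + f d"
    then obtain d where "d \<in> C - {c}" "f c \<le> l + f d" by blast
    then have "f c \<le> l * k + f d" using l by linarith
    then show ?thesis using \<open>d \<in> C - {c}\<close> assms(1) by (intro exI[of _ "{d}"]) auto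
  qed
qed

lemma covered_one_iff:
  assumes "finite C"
  shows "covered C l 1 f \<longleftrightarrow> (\<forall>c\<in>C. f c \<le> l \<or> (\<exists>d\<in>C - {c}. f c \<le> l + f d))"
proof
  assume c1: "covered C l 1 f"
  show "\<forall>c\<in>C. f c \<le> l \<or> (\<exists>d\<in>C - {c}. f c \<le> l + f d)"
  proof
    fix c assume "c \<in> C"
    then obtain D where D: "D \<subseteq> C - {c}" "card D \<le> 1" "f c \<le> l + sum f D"
      using c1 unfolding covered_def by fastforce
    have "finite D" using D(1) assms finite_subset by blast
    then have "D = {} \<or> (\<exists>d. D = {d})" using D(2) by (metis card_0_eq card_1_singletonE le_neq_implies_less less_one)
    then show "f c \<le> l \<or> (\<exists>d\<in>C - {c}. f c \<le> l + f d)" using D by auto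
  qed
qed (auto intro: coveredI_pointwise)

section \<open>Fairness as coverage\<close>

text \<open>The condition matters at one color \<open>a\<close> of largest count only, since
  \<open>{a}\<close> covers every other color. For \<open>a\<close> itself the best single other
  color has the second entry of the descending list as its count.\<close>

lemma fair_set_iff_covered:
  assumes "finite C"
  shows "fair_set C col l W \<longleftrightarrow> covered C l 1 (counts col W)"
proof -
  define f where "f = counts col W"
  define xs where "xs = color_counts C col W"
  have ms: "mset xs = image_mset f (mset_set C)"
    by (simp add: xs_def color_counts_def f_def)
  have srt: "sorted_wrt (\<ge>) xs"
    by (simp add: xs_def color_counts_def sorted_wrt_rev)
  show ?thesis
  proof (cases xs)
    case Nil
    then have "C = {}" using ms assms by (simp add: mset_set_empty_iff)
    then show ?thesis
      by (simp add: fair_set_def MoV_def covered_def color_counts_def)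
  next
    case (Cons x ys)
    \<comment> \<open>The head of the list is pulled back along \<open>f\<close> to a color
      \<open>a\<close>; the tail then lists the counts of \<open>C - {a}\<close>, with
      multiplicity.\<close>
    have "image_mset f (mset_set C) = add_mset x (mset ys)" using ms Cons by simp
    then obtain N a where N: "mset_set C = add_mset a N" "f a = x" "image_mset f N = mset ys"
      by (metis msed_map_invR)
    have a: "a \<in> C" using N(1) assms by (metis elem_mset_set union_single_eq_member)
    have "N = mset_set (C - {a})" using N(1) mset_set.remove[OF assms a] by simp
    then have ys: "mset ys = image_mset f (mset_set (C - {a}))" using N(3) by simp
    have setys: "set ys = f ` (C - {a})" using arg_cong[OF ys, of set_mset] assms by simp
    have le: "f d \<le> x" if "d \<in> C" for d
      using that srt Cons setys N(2) by (cases "d = a") auto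
    show ?thesis
    proof (cases ys)
      case Nil
      \<comment> \<open>With a single color the default 0 stands for the second largest value, and
        coverage likewise has no other color to draw on.\<close>
      then have "C = {a}" using setys a by auto
      then have "covered C l 1 f \<longleftrightarrow> x \<le> l" using N(2) covered_one_iff[OF assms, of l f] by simp
      moreover have "MoV C col W = x" using Nil Cons by (simp add: MoV_def flip: xs_def)
      ultimately show ?thesis by (simp add: fair_set_def f_def)
    next
      case (Cons y zs)
      then obtain b where b: "b \<in> C - {a}" "f b = y" using setys by (metis image_iff list.set_intros(1))
      have ley: "f d \<le> y" if "d \<in> C - {a}" for d
      proof -
        have "f d \<in> set ys" using that setys by blast
        then show ?thesis using srt \<open>xs = x # ys\<close> Cons by auto
      qed
      have "covered C l 1 f \<longleftrightarrow> x \<le> l + y"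
        unfolding covered_one_iff[OF assms]
      proof
        assume "\<forall>c\<in>C. f c \<le> l \<or> (\<exists>d\<in>C - {c}. f c \<le> l + f d)"
        then have "x \<le> l \<or> (\<exists>d\<in>C - {a}. x \<le> l + f d)" using a N(2) by blast
        then show "x \<le> l + y" using ley by fastforce
      next
        assume xy: "x \<le> l + y"
        show "\<forall>c\<in>C. f c \<le> l \<or> (\<exists>d\<in>C - {c}. f c \<le> l + f d)"
        proof
          fix c assume c: "c \<in> C"
          show "f c \<le> l \<or> (\<exists>d\<in>C - {c}. f c \<le> l + f d)"
          proof (cases "c = a")
            case True
            then show ?thesis using b xy N(2) by auto
          next
            case False
            then show ?thesis using a le[OF c] N(2) by (auto intro!: bexI[of _ a])
          qed
        qed
      qed
      moreover have "MoV C col W = x - y"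
        using \<open>xs = x # ys\<close> Cons by (simp add: MoV_def flip: xs_def)
      ultimately show ?thesis by (simp add: fair_set_def f_def le_diff_conv add.commute)
    qed
  qed
qed

section \<open>The inequality of the theorem as coverage\<close>

text \<open>Induction on \<open>k\<close>, removing the largest index: among \<open>k + 1\<close>
  distinct indices from 2 on, the largest is at least \<open>k + 2\<close>.\<close>

lemma sum_le_sum_initial:
  fixes a :: "nat \<Rightarrow> nat"
  assumes "\<And>i j. 1 \<le> i \<Longrightarrow> i \<le> j \<Longrightarrow> a j \<le> a i"
    and "finite J" "\<And>j. j \<in> J \<Longrightarrow> 2 \<le> j" "card J \<le> k"
  shows "sum a J \<le> (\<Sum>i\<in>{1..k}. a (i + 1))"
  using assms(2-4)
proof (induction k arbitrary: J)
  case 0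
  then show ?case by simp
next
  case (Suc k)
  show ?case
  proof (cases "card J \<le> k")
    case True
    have "sum a J \<le> (\<Sum>i\<in>{1..k}. a (i + 1))" using Suc True by blast
    then show ?thesis by simp
  next
    case False
    then have cJ: "card J = Suc k" using Suc.prems by simp
    then have ne: "J \<noteq> {}" by auto
    define m where "m = Max J"
    have m: "m \<in> J" using ne Suc.prems m_def by simp
    have "J \<subseteq> {2..m}" using Suc.prems m_def by auto
    then have "card J \<le> m - 1" using card_mono[of "{2..m}" J] by simp
    then have "k + 2 \<le> m" using cJ by simp
    then have am: "a m \<le> a (Suc (Suc k))" using assms(1) by simp
    have "sum a (J - {m}) \<le> (\<Sum>i\<in>{1..k}. a (i + 1))"
      using Suc.IH[of "J - {m}"] Suc.prems m cJ by simp
    then show ?thesis using am m Suc.prems by (simp add: sum.remove[of J m])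
  qed
qed

text \<open>Past \<open>card C\<close> the size drops to 0, so the order assumed up to
  \<open>card C\<close> extends to all indices from 1 on.\<close>

lemma class_size_antimono:
  assumes dec: "\<forall>i\<in>{1..card C - 1}. counts col U (c i) \<ge> counts col U (c (i + 1))"
    and "1 \<le> i" "i \<le> j"
  shows "class_size U C col c j \<le> class_size U C col c i"
  using \<open>i \<le> j\<close>
proof (induction j rule: dec_induct)
  case (step j)
  have "class_size U C col c (Suc j) \<le> class_size U C col c j"
    using dec step assms(2) by (auto simp: class_size_def)
  then show ?case using step by linarith
qed simp

text \<open>The critical color is \<open>c 1\<close>: for \<open>k > 0\<close> it covers every other
  color by itself. For \<open>c 1\<close> the best witness consists of the next \<open>k\<close>
  colors in the order.\<close>

lemma class_size_le_iff_covered: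
  assumes "finite C" "bij_betw c {1..card C} C"
    and dec: "\<forall>i\<in>{1..card C - 1}. counts col U (c i) \<ge> counts col U (c (i + 1))"
  shows "class_size U C col c 1 \<le> l * k + (\<Sum>i\<in>{1..k}. class_size U C col c (i + 1))
    \<longleftrightarrow> covered C l k (counts col U)"
proof (cases "C = {}")
  case True
  then show ?thesis by (simp add: class_size_def covered_def)
next
  case False
  define a where "a = class_size U C col c"
  define f where "f = counts col U"
  have anti: "a j \<le> a i" if "1 \<le> i" "i \<le> j" for i j
    using class_size_antimono[OF dec that] by (simp add: a_def)
  have fa: "f (c i) = a i" if "i \<le> card C" for i using that by (simp add: a_def f_def class_size_def)
  have a0: "a i = 0" if "i > card C" for i using that by (simp add: a_def class_size_def)
  have N: "card C \<ge> 1" using False assms(1) by (simp add: Suc_le_eq card_gt_0_iff)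
  have inj: "inj_on c {1..card C}" and im: "c ` {1..card C} = C"
    using assms(2) by (auto simp: bij_betw_def)
  have c1: "c 1 \<in> C" using im N by auto
  have "a 1 \<le> l * k + (\<Sum>i\<in>{1..k}. a (i + 1)) \<longleftrightarrow> covered C l k f"
  proof
    assume L: "a 1 \<le> l * k + (\<Sum>i\<in>{1..k}. a (i + 1))"
    show "covered C l k f"
      unfolding covered_def
    proof
      fix d assume d: "d \<in> C"
      then obtain i where i: "i \<in> {1..card C}" "d = c i" using im by blast
      have fd: "f d \<le> a 1" using fa anti[of 1 i] i by auto
      show "\<exists>D\<subseteq>C - {d}. card D \<le> k \<and> f d \<le> l * k + sum f D"
      proof (cases "d = c 1")
        case True
        \<comment> \<open>The indices are cut off at \<open>card C\<close>, where the enumeration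
          ends; those beyond contribute 0 to the sum.\<close>
        define J where "J = {i \<in> {2..k + 1}. i \<le> card C}"
        have J: "J \<subseteq> {1..card C}" "1 \<notin> J" by (auto simp: J_def)
        have "c ` J \<subseteq> C - {d}"
        proof -
          have "c ` J \<subseteq> C" using J im by blast
          moreover have "c 1 \<notin> c ` J" using J N inj_on_image_mem_iff[OF inj, of 1 J] by simp
          ultimately show ?thesis unfolding True by (simp only: subset_Diff_insert Diff_empty simp_thms)
        qed
        moreover have "card (c ` J) \<le> k"
        proof -
          have "card (c ` J) \<le> card J" by (rule card_image_le) (simp add: J_def)
          also have "\<dots> \<le> card {2..k + 1}" by (rule card_mono) (auto simp: J_def)
          finally show ?thesis by simp
        qed
        moreover have "sum f (c ` J) = (\<Sum>i\<in>{1..k}. a (i + 1))"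
        proof -
          have "sum f (c ` J) = sum (f \<circ> c) J" using inj J by (meson inj_on_subset sum.reindex)
          also have "\<dots> = sum a J" using fa by (intro sum.cong) (auto simp: J_def)
          also have "\<dots> = sum a {2..k + 1}"
            using a0 by (intro sum.mono_neutral_left) (auto simp: J_def not_le[symmetric])
          also have "\<dots> = (\<Sum>i\<in>{1..k}. a (i + 1))"
            using sum.shift_bounds_cl_nat_ivl[of a 1 1 k] by (simp add: numeral_2_eq_2)
          finally show ?thesis .
        qed
        ultimately show ?thesis using L fd by (intro exI[of _ "c ` J"]) auto
      next
        case False
        show ?thesis
        proof (cases "k = 0")
          case True
          \<comment> \<open>For \<open>k = 0\<close> the right side of \<open>L\<close> is 0, so all
            classes are empty.\<close>
          then show ?thesis using L fd by (intro exI[of _ "{}"]) auto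
        next
          case k: False
          then show ?thesis using False c1 fd fa[OF N] by (intro exI[of _ "{c 1}"]) auto
        qed
      qed
    qed
  next
    assume "covered C l k f"
    then obtain D where D: "D \<subseteq> C - {c 1}" "card D \<le> k" "f (c 1) \<le> l * k + sum f D"
      using c1 unfolding covered_def by blast
    \<comment> \<open>The indices of a witness for \<open>c 1\<close> avoid 1, so they start at 2
      and the sum over them is at most that of the first \<open>k\<close> such indices.\<close>
    define J where "J = {i \<in> {1..card C}. c i \<in> D}"
    have "D \<subseteq> c ` {1..card C}" using D(1) im by blast
    then have DJ: "D = c ` J" unfolding J_def by blast
    have injJ: "inj_on c J" using inj by (rule inj_on_subset) (auto simp: J_def)
    have "sum f D = sum a J"
      unfolding DJ sum.reindex[OF injJ] using fa by (intro sum.cong) (auto simp: J_def)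
    also have "\<dots> \<le> (\<Sum>i\<in>{1..k}. a (i + 1))"
    proof (rule sum_le_sum_initial)
      show "card J \<le> k" using D(2) card_image[OF injJ] DJ by simp
      show "2 \<le> j" if "j \<in> J" for j
      proof -
        have "j \<noteq> 1" "j \<ge> 1" using that D(1) by (auto simp: J_def)
        then show ?thesis by linarith
      qed
    qed (use anti in \<open>auto simp: J_def\<close>)
    finally show "a 1 \<le> l * k + (\<Sum>i\<in>{1..k}. a (i + 1))" using D(3) fa[OF N] by simp
  qed
  then show ?thesis by (simp add: a_def f_def)
qed

section \<open>From matchings to assignments and count vectors\<close>

text \<open>Disjointness of \<open>U\<close> and \<open>V\<close> fixes which end of an unordered
  edge lies on the left, and completeness makes the graph of any map from \<open>U\<close> to
  \<open>V\<close> a set of edges. The predicate \<open>Q\<close> is left open to serve both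
  versions of the problem.\<close>

lemma matching_iff_assignment:
  assumes "complete_bipartite_graph U V E"
  shows "(\<exists>M. many_to_one_matching U E M \<and> left_perfect U M \<and> (\<forall>v\<in>V. Q (partners M v)))
    \<longleftrightarrow> (\<exists>\<phi>. \<phi> ` U \<subseteq> V \<and> (\<forall>v\<in>V. Q {u \<in> U. \<phi> u = v}))"
proof
  have E: "E = {{u, v} |u v. u \<in> U \<and> v \<in> V}" and dj: "U \<inter> V = {}"
    using assms by (auto simp: complete_bipartite_graph_def bipartite_graph_def bipartite_edges_def)
  {
    assume "\<exists>M. many_to_one_matching U E M \<and> left_perfect U M \<and> (\<forall>v\<in>V. Q (partners M v))"
    then obtain M where M: "M \<subseteq> E" "\<And>u. u \<in> U \<Longrightarrow> card (partners M u) = 1"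
      and Q: "\<forall>v\<in>V. Q (partners M v)"
      by (auto simp: many_to_one_matching_def left_perfect_def)
    have "\<forall>u\<in>U. \<exists>v. partners M u = {v}" using M(2) card_1_singletonE by blast
    then obtain \<phi> where \<phi>: "\<And>u. u \<in> U \<Longrightarrow> partners M u = {\<phi> u}" by metis
    have "\<phi> u \<in> V" if u: "u \<in> U" for u
    proof -
      have "{u, \<phi> u} \<in> E" using \<phi>[OF u] M(1) unfolding partners_def by blast
      then show ?thesis using u dj unfolding E by (auto simp: doubleton_eq_iff)
    qed
    moreover have "{u \<in> U. \<phi> u = v} = partners M v" if v: "v \<in> V" for v
    proof
      show "{u \<in> U. \<phi> u = v} \<subseteq> partners M v"
        using \<phi> unfolding partners_def by (auto simp: insert_commute)
      show "partners M v \<subseteq> {u \<in> U. \<phi> u = v}"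
      proof
        fix w assume w: "w \<in> partners M v"
        then have "{v, w} \<in> E" using M(1) by (auto simp: partners_def)
        then have wU: "w \<in> U" using v dj unfolding E by (auto simp: doubleton_eq_iff)
        have "v \<in> partners M w" using w by (simp add: partners_def insert_commute)
        then show "w \<in> {u \<in> U. \<phi> u = v}" using \<phi>[OF wU] wU by simp
      qed
    qed
    ultimately show "\<exists>\<phi>. \<phi> ` U \<subseteq> V \<and> (\<forall>v\<in>V. Q {u \<in> U. \<phi> u = v})"
      using Q by (intro exI[of _ \<phi>]) auto
  }
  assume "\<exists>\<phi>. \<phi> ` U \<subseteq> V \<and> (\<forall>v\<in>V. Q {u \<in> U. \<phi> u = v})"
  then obtain \<phi> where \<phi>: "\<phi> ` U \<subseteq> V" "\<forall>v\<in>V. Q {u \<in> U. \<phi> u = v}" by blast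
  define M where "M = {{u, \<phi> u} |u. u \<in> U}"
  have "M \<subseteq> E" using \<phi>(1) unfolding M_def E by blast
  moreover have "partners M u = {\<phi> u}" if "u \<in> U" for u
    using that \<phi>(1) dj unfolding partners_def M_def by (auto simp: doubleton_eq_iff)
  moreover have "partners M v = {u \<in> U. \<phi> u = v}" if "v \<in> V" for v
    using that \<phi>(1) dj unfolding partners_def M_def by (auto simp: doubleton_eq_iff)
  ultimately show "\<exists>M. many_to_one_matching U E M \<and> left_perfect U M \<and> (\<forall>v\<in>V. Q (partners M v))"
    using \<phi>(2) by (intro exI[of _ M]) (auto simp: many_to_one_matching_def left_perfect_def)
qed

text \<open>Realizes a count vector by elements, so that all splitting can be argued on vectors
  alone.\<close>

lemma obtain_subset_with_counts:
  assumes "finite U" "\<And>c. g c \<le> counts col U c"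
  obtains W where "W \<subseteq> U" "counts col W = g" "counts col (U - W) = (\<lambda>c. counts col U c - g c)"
proof -
  have "\<exists>S. S \<subseteq> color_class col U c \<and> card S = g c" for c
    using obtain_subset_with_card_n[OF assms(2)[of c]] by metis
  then obtain S where S: "\<And>c. S c \<subseteq> color_class col U c" "\<And>c. card (S c) = g c" by metis
  define W where "W = (\<Union>c. S c)"
  have WU: "W \<subseteq> U" using S(1) by (auto simp: W_def color_class_def)
  have WS: "color_class col W c = S c" for c using S(1) by (auto simp: W_def color_class_def)
  have "color_class col (U - W) c = color_class col U c - S c" for c
    unfolding WS[symmetric] by (auto simp: color_class_def)
  moreover have "finite (S c)" for c using S(1) assms(1)
    by (metis (no_types, lifting) WS WU color_class_def finite_subset mem_Collect_eq subsetI)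
  ultimately have "counts col (U - W) c = counts col U c - g c" for c
    using S by (simp add: card_Diff_subset)
  then show ?thesis using that[OF WU] WS S(2) by auto
qed

text \<open>\<open>R k\<close> is the invariant of the counts still to be distributed over
  \<open>k\<close> right vertices, and \<open>Q\<close> is the demand on each part. Vertices are
  served one by one, and the last one takes all that is left.\<close>

lemma assignment_of_splitting:
  assumes "finite V" "V \<noteq> {}" "finite U"
    and base: "\<And>f. R 1 f \<Longrightarrow> Q f"
    and step: "\<And>k f. k \<ge> 1 \<Longrightarrow> R (Suc k) f \<Longrightarrow>
      \<exists>g. (\<forall>c. g c \<le> f c) \<and> Q g \<and> R k (\<lambda>c. f c - g c)"
    and "R (card V) (counts col U)"
  shows "\<exists>\<phi>. \<phi> ` U \<subseteq> V \<and> (\<forall>v\<in>V. Q (counts col {u \<in> U. \<phi> u = v}))"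
  using assms(1,2,3,6)
proof (induction V arbitrary: U rule: finite_ne_induct)
  case (singleton v)
  then show ?case using base by (intro exI[of _ "\<lambda>_. v"]) auto
next
  case (insert v V)
  have "card V \<ge> 1" using insert.hyps by (simp add: Suc_le_eq card_gt_0_iff)
  then obtain g where g: "\<And>c. g c \<le> counts col U c" "Q g"
    "R (card V) (\<lambda>c. counts col U c - g c)"
    using step[of "card V" "counts col U"] insert by auto
  obtain W where W: "W \<subseteq> U" "counts col W = g"
    "counts col (U - W) = (\<lambda>c. counts col U c - g c)"
    using obtain_subset_with_counts[of U g col] g(1) insert.prems by blast
  obtain \<phi> where \<phi>: "\<phi> ` (U - W) \<subseteq> V" "\<forall>w\<in>V. Q (counts col {u \<in> U - W. \<phi> u = w})"
    using insert.IH[of "U - W"] insert.prems g(3) W(3) by auto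
  define \<psi> where "\<psi> u = (if u \<in> W then v else \<phi> u)" for u
  have "{u \<in> U. \<psi> u = v} = W" using W(1) \<phi>(1) insert.hyps by (auto simp: \<psi>_def)
  moreover have "{u \<in> U. \<psi> u = w} = {u \<in> U - W. \<phi> u = w}" if "w \<in> V" for w
    using that insert.hyps by (auto simp: \<psi>_def)
  ultimately show ?case using \<phi> g(2) W(2)
    by (intro exI[of _ \<psi>]) (auto simp: \<psi>_def)
qed

section \<open>Splitting off one fair part\<close>

lemma obtain_maximizer:
  fixes f :: "'b \<Rightarrow> nat"
  assumes "finite A" "A \<noteq> {}"
  obtains x where "x \<in> A" "\<And>y. y \<in> A \<Longrightarrow> f y \<le> f x"
proof -
  have "Max (f ` A) \<in> f ` A" using assms by simp
  then obtain x where "x \<in> A" "f x = Max (f ` A)" by force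
  then show ?thesis using that[of x] assms(1) by simp
qed

text \<open>The part takes the excess \<open>m\<close> of a violating color \<open>c\<close> over
  \<open>l * k\<close> plus the best \<open>k\<close> other colors \<open>D0\<close>, and
  \<open>m - l\<close> elements of a further color if \<open>m > l\<close>. Then \<open>D0\<close>
  covers what remains of \<open>c\<close>, and \<open>{c}\<close> covers every other color. The
  remainder is automatically large enough for nonempty parts later.\<close>

lemma split_off_if_not_covered:
  assumes C: "finite C" and k: "k \<ge> 1"
    and cov: "covered C l (Suc k) f" and ncov: "\<not> covered C l k f"
  shows "\<exists>g. (\<forall>c. g c \<le> f c) \<and> covered C l 1 g \<and> 0 < sum g C \<and>
    covered C l k (\<lambda>c. f c - g c) \<and> (if l = 0 then 2 else 1) * k \<le> (\<Sum>c\<in>C. f c - g c)"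
proof -
  obtain c where c: "c \<in> C"
    and nc: "\<And>D. D \<subseteq> C - {c} \<Longrightarrow> card D \<le> k \<Longrightarrow> l * k + sum f D < f c"
    using ncov unfolding covered_def by (meson not_le)
  define F where "F = {D. D \<subseteq> C - {c} \<and> card D \<le> k}"
  have "finite F" using C by (auto simp: F_def intro: finite_subset[of _ "Pow C"])
  moreover have "{} \<in> F" by (simp add: F_def)
  then have "F \<noteq> {}" by blast
  ultimately obtain D0 where D0: "D0 \<in> F" "\<And>D. D \<in> F \<Longrightarrow> sum f D \<le> sum f D0"
    using obtain_maximizer[of F "sum f"] by blast
  have D0C: "D0 \<subseteq> C - {c}" "finite D0" using D0(1) C by (auto simp: F_def intro: finite_subset)
  define m where "m = f c - l * k - sum f D0"
  have m: "f c = m + l * k + sum f D0" "m > 0"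
    using nc[of D0] D0(1) by (auto simp: m_def F_def)
  obtain D where D: "D \<subseteq> C - {c}" "card D \<le> Suc k" "f c \<le> l * Suc k + sum f D"
    using cov c unfolding covered_def by blast
  have finD: "finite D" using D(1) C by (meson finite_Diff finite_subset)
  have le_D0: "f d \<le> sum f D0" if "d \<in> C - {c}" for d
    using D0(2)[of "{d}"] that k by (auto simp: F_def)
  \<comment> \<open>\<open>D0\<close> stays untouched so that it can cover the rest of
    \<open>c\<close>. The positive color outside \<open>D0\<close> in \<open>gl\<close> is kept for
    the size bound in the case \<open>l = 0\<close>.\<close>
  obtain g where g: "\<And>d. g d \<le> f d" "g c = m" "covered C l 1 g" "\<And>d. d \<in> D0 \<Longrightarrow> g d = 0"
    and gl: "l = 0 \<Longrightarrow> \<exists>e\<in>C - {c} - D0. f e > 0"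
  proof (cases "m \<le> l")
    case True
    have "covered C l 1 (\<lambda>d. if d = c then m else 0)"
      using True by (intro coveredI_pointwise) auto
    moreover have "l \<noteq> 0" using True m by simp
    ultimately show ?thesis using m D0C by (intro that[of "\<lambda>d. if d = c then m else 0"]) auto
  next
    case False
    \<comment> \<open>Otherwise the covering of \<open>c\<close> by \<open>D\<close> would bound the
      excess \<open>m\<close> by \<open>l\<close>.\<close>
    have "\<not> D \<subseteq> D0"
    proof
      assume "D \<subseteq> D0"
      then have "sum f D \<le> sum f D0" using D0C by (intro sum_mono2) auto
      then show False using D(3) m False by simp
    qed
    then obtain e where e: "e \<in> D" "e \<notin> D0" by blast
    \<comment> \<open>Without \<open>e\<close> the set \<open>D\<close> has at most \<open>k\<close>
      colors, so it competes with \<open>D0\<close>; hence \<open>e\<close> alone supplies at least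
      \<open>m - l\<close>.\<close>
    have "sum f (D - {e}) \<le> sum f D0"
      using D(1,2) e finD by (intro D0(2)) (auto simp: F_def)
    moreover have "sum f D = f e + sum f (D - {e})" using e finD by (simp add: sum.remove)
    ultimately have fe: "m - l \<le> f e" using D(3) m by simp
    define g where "g = (\<lambda>d. if d = c then m else if d = e then m - l else 0)"
    have ec: "e \<noteq> c" "e \<in> C" using e D(1) by auto
    have "covered C l 1 g"
    proof (rule coveredI_pointwise)
      fix d assume "d \<in> C"
      show "g d \<le> l \<or> (\<exists>d'\<in>C - {d}. g d \<le> l + g d')"
        using ec c by (cases "d = c"; cases "d = e") (auto simp: g_def)
    qed simp
    moreover have "\<exists>e\<in>C - {c} - D0. f e > 0" if "l = 0"
      using that e ec fe False by (intro bexI[of _ e]) auto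
    ultimately show ?thesis using m D0C e ec fe by (intro that[of g]) (auto simp: g_def)
  qed
  have cov': "covered C l k (\<lambda>d. f d - g d)"
    unfolding covered_def
  proof
    fix d assume d: "d \<in> C"
    show "\<exists>D\<subseteq>C - {d}. card D \<le> k \<and> f d - g d \<le> l * k + (\<Sum>x\<in>D. f x - g x)"
    proof (cases "d = c")
      case True
      then show ?thesis using D0C D0(1) g m by (intro exI[of _ D0]) (auto simp: F_def)
    next
      case False
      have "f d - g d \<le> f c - g c" using le_D0[of d] d False g(2) m by simp
      then show ?thesis using False c k by (intro exI[of _ "{c}"]) auto
    qed
  qed
  have "0 < sum g C" using c g(2) m C by (metis member_le_sum order_less_le_trans zero_le)
  moreover have "(if l = 0 then 2 else 1) * k \<le> (\<Sum>c\<in>C. f c - g c)"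
  proof -
    \<comment> \<open>\<open>sum f D0\<close> is counted twice: once in the untouched
      \<open>D0\<close>, once in the \<open>l * k + sum f D0\<close> that remain of
      \<open>c\<close>.\<close>
    have "(\<Sum>d\<in>insert c D0. f d - g d) \<le> (\<Sum>d\<in>C. f d - g d)"
      using c D0C C by (intro sum_mono2) auto
    moreover have "(\<Sum>d\<in>insert c D0. f d - g d) = (f c - g c) + sum f D0"
      using D0C g(4) by (subst sum.insert) auto
    ultimately have big: "l * k + 2 * sum f D0 \<le> (\<Sum>d\<in>C. f d - g d)" using g(2) m by simp
    show ?thesis
    proof (cases "l = 0")
      case False
      then have "k \<le> l * k" by simp
      then have "k \<le> (\<Sum>d\<in>C. f d - g d)" using big by linarith
      then show ?thesis using False by simp
    next
      case True
      then obtain e where e: "e \<in> C - {c} - D0" "f e > 0" using gl by blast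
      define P where "P = {d \<in> C - {c}. f d > 0}"
      \<comment> \<open>If at most \<open>k\<close> other colors were present, the optimal
        \<open>D0\<close> would exhaust them all, leaving no room for \<open>e\<close>.\<close>
      have "\<not> card P \<le> k"
      proof
        assume "card P \<le> k"
        then have "sum f P \<le> sum f D0" by (intro D0(2)) (auto simp: F_def P_def)
        moreover have "sum f (insert e D0) \<le> sum f (C - {c})"
          using e D0C C by (intro sum_mono2) auto
        moreover have "sum f (C - {c}) = sum f P"
          using C by (intro sum.mono_neutral_right) (auto simp: P_def)
        ultimately show False using e D0C by simp
      qed
      then obtain S where S: "S \<subseteq> P" "card S = k"
        using obtain_subset_with_card_n[of k P] by auto
      \<comment> \<open>Any \<open>k\<close> colors that are present contain at least
        \<open>k\<close> elements, so the optimal \<open>D0\<close> does too.\<close>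
      have "1 \<le> f d" if "d \<in> S" for d using that S(1) by (auto simp: P_def)
      then have "k \<le> sum f S" using S(2) sum_mono[of S "\<lambda>_. 1" f] by simp
      also have "\<dots> \<le> sum f D0" using S by (intro D0(2)) (auto simp: F_def P_def)
      finally show ?thesis using big True by simp
    qed
  qed
  ultimately show ?thesis using g(1,3) cov' by blast
qed

lemma split_off_fair:
  assumes "finite C" "k \<ge> 1" "covered C l (Suc k) f"
  shows "\<exists>g. (\<forall>c. g c \<le> f c) \<and> covered C l 1 g \<and> covered C l k (\<lambda>c. f c - g c)"
proof (cases "covered C l k f")
  case True
  then show ?thesis by (intro exI[of _ "\<lambda>_. 0"]) (auto intro: coveredI_pointwise)
next
  case False
  then show ?thesis using split_off_if_not_covered[OF assms] by blast
qed

section \<open>Nonempty fair parts of a vector that is already covered\<close>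

lemma obtain_max_color:
  fixes f :: "'c \<Rightarrow> nat"
  assumes "finite C" "0 < sum f C"
  obtains c where "c \<in> C" "0 < f c" "\<And>d. d \<in> C \<Longrightarrow> f d \<le> f c"
proof -
  have "C \<noteq> {}" using assms by auto
  then obtain c where c: "c \<in> C" "\<And>d. d \<in> C \<Longrightarrow> f d \<le> f c"
    using obtain_maximizer[OF assms(1), of f] by blast
  moreover have "0 < f c" using assms(2) c
    by (metis bot_nat_0.not_eq_extremum le_zero_eq sum.neutral)
  ultimately show ?thesis using that by blast
qed

text \<open>Taking the element from a color \<open>c\<close> of largest count leaves the witness for
  \<open>c\<close> intact. Any other color is at most \<open>f c\<close>, and
  \<open>l * k \<ge> 1\<close> makes up for the unit that \<open>c\<close> lost.\<close>

lemma split_off_singleton: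
  assumes C: "finite C" and k: "k \<ge> 1" and "l > 0"
    and cov: "covered C l k f" and n: "Suc k \<le> sum f C"
  shows "\<exists>g. (\<forall>c. g c \<le> f c) \<and> covered C l 1 g \<and> 0 < sum g C \<and>
    covered C l k (\<lambda>c. f c - g c) \<and> k \<le> (\<Sum>c\<in>C. f c - g c)"
proof -
  obtain c where c: "c \<in> C" "0 < f c" "\<And>d. d \<in> C \<Longrightarrow> f d \<le> f c"
    using obtain_max_color[OF C, of f] n by auto
  define g where "g d = (if d = c then 1 else 0 :: nat)" for d
  have le: "\<forall>d. g d \<le> f d" using c by (simp add: g_def)
  have "covered C l 1 g" using \<open>l > 0\<close> by (intro coveredI_pointwise) (auto simp: g_def)
  moreover have sg: "sum g C = 1" using c C by (simp add: g_def)
  moreover have "covered C l k (\<lambda>d. f d - g d)"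
    unfolding covered_def
  proof
    fix d assume d: "d \<in> C"
    show "\<exists>D\<subseteq>C - {d}. card D \<le> k \<and> f d - g d \<le> l * k + (\<Sum>x\<in>D. f x - g x)"
    proof (cases "d = c")
      case True
      obtain D where D: "D \<subseteq> C - {c}" "card D \<le> k" "f c \<le> l * k + sum f D"
        using cov c(1) unfolding covered_def by blast
      have "(\<Sum>x\<in>D. f x - g x) = sum f D" using D(1) by (intro sum.cong) (auto simp: g_def)
      then show ?thesis using D True by (intro exI[of _ D]) auto
    next
      case False
      have "1 \<le> l * k" using k \<open>l > 0\<close> by simp
      then have "f d - g d \<le> l * k + (f c - g c)"
        using c(3)[OF d] c(2) False by (cases "f c") (auto simp: g_def simp del: One_nat_def)
      then show ?thesis using False c(1) k by (intro exI[of _ "{c}"]) auto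
    qed
  qed
  moreover have "(\<Sum>d\<in>C. f d - g d) = sum f C - sum g C" using le by (simp add: sum_subtractf_nat)
  ultimately show ?thesis using le n by (intro exI[of _ g]) auto
qed

text \<open>Without slack a nonempty fair part needs two colors. One is \<open>a\<close>, of largest
  count; the choice of the other, and whether a pair suffices, depends on how many colors tie with
  \<open>a\<close>.\<close>

lemma split_off_pair:
  assumes C: "finite C" and k: "k \<ge> 1"
    and cov: "covered C 0 k f" and n: "2 * Suc k \<le> sum f C"
  shows "\<exists>g. (\<forall>c. g c \<le> f c) \<and> covered C 0 1 g \<and> 0 < sum g C \<and>
    covered C 0 k (\<lambda>c. f c - g c) \<and> 2 * k \<le> (\<Sum>c\<in>C. f c - g c)"
proof -
  obtain a where a: "a \<in> C" "0 < f a" "\<And>d. d \<in> C \<Longrightarrow> f d \<le> f a"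
    using obtain_max_color[OF C, of f] n by auto
  define p where "p b = (\<lambda>d. if d = a \<or> d = b then 1 else 0 :: nat)" for b
  have pair: ?thesis
    if b: "b \<in> C - {a}" "0 < f b" and cv: "covered C 0 k (\<lambda>d. f d - p b d)" for b
  proof -
    have le: "\<forall>d. p b d \<le> f d" using a b by (simp add: p_def)
    have "covered C 0 1 (p b)"
    proof (rule coveredI_pointwise)
      fix d
      show "p b d \<le> 0 \<or> (\<exists>d'\<in>C - {d}. p b d \<le> 0 + p b d')"
        using a b by (cases "d = a"; cases "d = b") (auto simp: p_def)
    qed simp
    moreover have "sum (p b) C = 2"
    proof -
      have "sum (p b) C = sum (p b) {a, b}"
        using a b C by (intro sum.mono_neutral_right) (auto simp: p_def)
      also have "\<dots> = p b a + p b b" using b by (subst sum.insert) auto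
      finally show ?thesis by (simp add: p_def)
    qed
    moreover have "(\<Sum>d\<in>C. f d - p b d) = sum f C - sum (p b) C"
      using le by (simp add: sum_subtractf_nat)
    ultimately show ?thesis using le n cv by (intro exI[of _ "p b"]) auto
  qed
  show ?thesis
  proof (cases "\<exists>b\<in>C - {a}. f b = f a")
    case False
    obtain D where D: "D \<subseteq> C - {a}" "card D \<le> k" "f a \<le> sum f D"
      using cov a(1) unfolding covered_def by auto
    have finD: "finite D" using D(1) C by (meson finite_Diff finite_subset)
    \<comment> \<open>Drawing \<open>b\<close> from the witness for \<open>a\<close> lowers
      \<open>f a\<close> and the total of \<open>D\<close> by one each, so \<open>D\<close> still
      covers \<open>a\<close>.\<close>
    obtain b where b: "b \<in> D" "0 < f b" using D(3) a(2)
      by (metis bot_nat_0.not_eq_extremum le_zero_eq sum.neutral)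
    show ?thesis
    proof (rule pair)
      show "covered C 0 k (\<lambda>d. f d - p b d)"
        unfolding covered_def
      proof
        fix d assume d: "d \<in> C"
        show "\<exists>D\<subseteq>C - {d}. card D \<le> k \<and> f d - p b d \<le> 0 * k + (\<Sum>x\<in>D. f x - p b x)"
        proof (cases "d = a")
          case True
          have "(\<Sum>x\<in>D. f x - p b x) = (f b - 1) + (\<Sum>x\<in>D - {b}. f x - p b x)"
            using b finD by (simp add: sum.remove p_def)
          also have "(\<Sum>x\<in>D - {b}. f x - p b x) = sum f (D - {b})"
            using D(1) by (intro sum.cong) (auto simp: p_def)
          also have "(f b - 1) + sum f (D - {b}) = sum f D - 1"
            using b finD by (simp add: sum.remove)
          finally show ?thesis using D True by (intro exI[of _ D]) (auto simp: p_def)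
        next
          case dn: False
          have "f d < f a" using False a(3)[OF d] d dn by (metis DiffI le_neq_implies_less singletonD)
          then have "f d - p b d \<le> f a - p b a" by (simp add: p_def)
          then show ?thesis using dn a(1) k by (intro exI[of _ "{a}"]) auto
        qed
      qed
    qed (use b D in auto)
  next
    case True
    then obtain b where b: "b \<in> C - {a}" "f b = f a" by blast
    show ?thesis
    proof (cases "\<exists>e\<in>C - {a, b}. f e = f a")
      case False
      \<comment> \<open>In a twofold tie \<open>a\<close> and \<open>b\<close> remain tied and cover
        each other; all other counts are strictly smaller, hence at most
        \<open>f a - 1\<close>.\<close>
      show ?thesis
      proof (rule pair)
        show "covered C 0 k (\<lambda>d. f d - p b d)"
        proof (rule coveredI_pointwise[OF k])
          fix d assume d: "d \<in> C"
          show "f d - p b d \<le> 0 \<or> (\<exists>d'\<in>C - {d}. f d - p b d \<le> 0 + (f d' - p b d'))"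
          proof (cases "d = a")
            case True
            then show ?thesis using b by (auto simp: p_def)
          next
            case dn: False
            have "f d - p b d \<le> f a - p b a"
            proof (cases "d = b")
              case True
              then show ?thesis using b by (simp add: p_def)
            next
              case db: False
              then have "f d < f a" using False a(3)[OF d] d dn by (metis DiffI insertE le_neq_implies_less singletonD)
              then show ?thesis by (simp add: p_def)
            qed
            then show ?thesis using dn a(1) by auto
          qed
        qed
      qed (use b a in auto)
    next
      case True
      then obtain e where e: "e \<in> C - {a, b}" "f e = f a" by blast
      \<comment> \<open>With three tied colors, an untouched one may exceed both \<open>a\<close>
        and \<open>b\<close>. For \<open>k \<ge> 2\<close> these two cover it jointly, since
        \<open>2 * (f a - 1) \<ge> f a\<close> once \<open>f a \<ge> 2\<close>; for
        \<open>f a = 1\<close> a fourth color does so.\<close>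
      consider "f a = 1" | "f a \<ge> 2" "k \<ge> 2" | "f a \<ge> 2" "k = 1" using a(2) k by linarith
      then show ?thesis
      proof cases
        case 1
        show ?thesis
        proof (rule pair)
          show "covered C 0 k (\<lambda>d. f d - p b d)"
          proof (rule coveredI_pointwise[OF k])
            fix d assume d: "d \<in> C"
            show "f d - p b d \<le> 0 \<or> (\<exists>d'\<in>C - {d}. f d - p b d \<le> 0 + (f d' - p b d'))"
            proof (cases "d \<in> {a, b}")
              case True
              then show ?thesis using b 1 by (intro disjI1) (auto simp: p_def)
            next
              case False
              \<comment> \<open>The total is at least \<open>2 * Suc k \<ge> 4\<close>, so three
                colors of count at most 1 cannot be all.\<close>
              have "sum f {a, b, d} \<le> 3" using a(3)[OF d] b 1 False by auto
              have "\<exists>d'\<in>C - {a, b, d}. f d' \<noteq> 0"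
              proof (rule ccontr)
                assume "\<not> ?thesis"
                then have "sum f C = sum f {a, b, d}"
                  using C a b d by (intro sum.mono_neutral_right) auto
                then show False using n k \<open>sum f {a, b, d} \<le> 3\<close> by simp
              qed
              then obtain d' where "d' \<in> C - {a, b, d}" "f d' \<noteq> 0" by blast
              then show ?thesis using a(3)[OF d] 1 by (intro disjI2 bexI[of _ d']) (auto simp: p_def)
            qed
          qed
        qed (use b a in auto)
      next
        case 2
        show ?thesis
        proof (rule pair)
          show "covered C 0 k (\<lambda>d. f d - p b d)"
            unfolding covered_def
          proof
            fix d assume d: "d \<in> C"
            show "\<exists>D\<subseteq>C - {d}. card D \<le> k \<and> f d - p b d \<le> 0 * k + (\<Sum>x\<in>D. f x - p b x)"
            proof (cases "d \<in> {a, b}")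
              case True
              then show ?thesis using e b k by (intro exI[of _ "{e}"]) (auto simp: p_def)
            next
              case False
              have "(\<Sum>x\<in>{a, b}. f x - p b x) = (f a - 1) + (f a - 1)"
                using b by (subst sum.insert) (auto simp: p_def)
              moreover have "f d - p b d \<le> (f a - 1) + (f a - 1)" using a(3)[OF d] 2 by linarith
              moreover have "card {a, b} \<le> k" using b 2 by (auto simp: card_insert_if)
              ultimately show ?thesis using False a(1) b by (intro exI[of _ "{a, b}"]) auto
            qed
          qed
        qed (use b a in auto)
      next
        case 3
        \<comment> \<open>Removing a pair from a threefold tie would leave an unfair remainder, and the remainder has
          to be a single fair set here, so every tied color is lowered by one.\<close>
        define g where "g d = (if d \<in> C \<and> f d = f a then 1 else 0 :: nat)" for d
        have g1: "g d \<le> 1" for d by (simp add: g_def)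
        have ab: "g a = 1" "g b = 1" using a b by (auto simp: g_def)
        have le: "\<forall>d. g d \<le> f d" using a(2) by (simp add: g_def)
        \<comment> \<open>Whatever \<open>d\<close> is, one of the tied colors \<open>a\<close> and
          \<open>b\<close> differs from it and can cover it, both in the part and in the
          remainder.\<close>
        have tie: "\<exists>d'\<in>C - {d}. d' \<in> {a, b}" for d using a b by auto
        have "covered C 0 1 g"
        proof (rule coveredI_pointwise)
          fix d
          obtain d' where "d' \<in> C - {d}" "d' \<in> {a, b}" using tie by blast
          then show "g d \<le> 0 \<or> (\<exists>d'\<in>C - {d}. g d \<le> 0 + g d')"
            using ab g1[of d] by (intro disjI2 bexI[of _ d']) auto
        qed simp
        moreover have "covered C 0 k (\<lambda>d. f d - g d)"
        proof (rule coveredI_pointwise[OF k])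
          fix d assume d: "d \<in> C"
          obtain d' where d': "d' \<in> C - {d}" "d' \<in> {a, b}" using tie by blast
          have "f d - g d \<le> f a - 1" using a(3)[OF d] d by (auto simp: g_def)
          also have "\<dots> = f d' - g d'" using d' ab b by auto
          finally show "f d - g d \<le> 0 \<or> (\<exists>d'\<in>C - {d}. f d - g d \<le> 0 + (f d' - g d'))"
            using d' by auto
        qed
        moreover have "0 < sum g C" using a(1) ab C
          by (metis less_numeral_extra(1) member_le_sum order_less_le_trans zero_le)
        moreover have "2 * k \<le> (\<Sum>d\<in>C. f d - g d)"
        proof -
          \<comment> \<open>As \<open>f a \<ge> 2\<close>, each of \<open>a\<close> and
            \<open>b\<close> keeps an element, which is enough for \<open>k = 1\<close>.\<close>
          have "(\<Sum>d\<in>{a, b}. f d - g d) \<le> (\<Sum>d\<in>C. f d - g d)"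
            using a b C by (intro sum_mono2) auto
          moreover have "2 \<le> (\<Sum>d\<in>{a, b}. f d - g d)" using b ab 3 by auto
          ultimately show ?thesis using 3 by simp
        qed
        ultimately show ?thesis using le by blast
      qed
    qed
  qed
qed

text \<open>The factor 2 or 1 bounds the size of a nonempty \<open>l\<close>-fair set from below.
  Carrying it along with coverage leaves enough elements for every later vertex.\<close>

lemma split_off_fair_nonempty:
  assumes "finite C" "k \<ge> 1" "covered C l (Suc k) f"
    and "(if l = 0 then 2 else 1) * Suc k \<le> sum f C"
  shows "\<exists>g. (\<forall>c. g c \<le> f c) \<and> (covered C l 1 g \<and> 0 < sum g C) \<and>
    covered C l k (\<lambda>c. f c - g c) \<and> (if l = 0 then 2 else 1) * k \<le> (\<Sum>c\<in>C. f c - g c)"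
proof (cases "covered C l k f")
  case False
  then show ?thesis using split_off_if_not_covered[OF assms(1-3)] by simp
next
  case True
  show ?thesis
  proof (cases "l = 0")
    case l: True
    then show ?thesis using split_off_pair[of C k f] assms True by simp
  next
    case False
    then show ?thesis using split_off_singleton[of C k l f] assms True by simp
  qed
qed

section \<open>Fibers of an assignment and the characterization\<close>

lemma sum_counts:
  assumes "finite U" "finite C" "col ` U \<subseteq> C"
  shows "sum (counts col U) C = card U"
  using sum.group[OF assms, of "\<lambda>_. 1 :: nat"] by (simp add: color_class_def)

lemma counts_eq_sum_fibers:
  assumes "finite U" "finite V" "\<phi> ` U \<subseteq> V"
  shows "counts col U = (\<lambda>c. \<Sum>v\<in>V. counts col {u \<in> U. \<phi> u = v} c)"
proof
  fix c
  have "(\<Sum>v\<in>V. card {u \<in> color_class col U c. \<phi> u = v}) = card (color_class col U c)"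
    using assms sum.group[of "color_class col U c" V \<phi> "\<lambda>_. 1 :: nat"]
    by (auto simp: color_class_def)
  moreover have "{u \<in> color_class col U c. \<phi> u = v} = color_class col {u \<in> U. \<phi> u = v} c" for v
    by (auto simp: color_class_def)
  ultimately show "counts col U c = (\<Sum>v\<in>V. counts col {u \<in> U. \<phi> u = v} c)" by simp
qed

text \<open>With \<open>l = 0\<close> the color of any element must be matched by another color of
  at least the same count, so a second color occurs.\<close>

lemma covered_zero_card_ge_2:
  assumes "finite W" "finite C" "col ` W \<subseteq> C" "W \<noteq> {}" "covered C 0 1 (counts col W)"
  shows "2 \<le> card W"
proof -
  obtain w where w: "w \<in> W" using assms(4) by blast
  have "0 < counts col W (col w)" using w assms(1) by (auto simp: color_class_def card_gt_0_iff)
  moreover have "col w \<in> C" using w assms(3) by blast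
  ultimately obtain d where "d \<in> C - {col w}" "0 < counts col W d"
    using assms(5) unfolding covered_one_iff[OF assms(2)] by force
  then obtain w' where "w' \<in> W" "col w' \<noteq> col w"
    by (auto simp: color_class_def card_gt_0_iff)
  then have "card {w, w'} \<le> card W" "w \<noteq> w'" using w assms(1) by (auto intro: card_mono)
  then show ?thesis by simp
qed

theorem theorem26:
  fixes U V :: "'a set" and E :: "'a set set"
    and C :: "'c set" and col :: "'a \<Rightarrow> 'c"
    and l n k :: nat and c :: "nat \<Rightarrow> 'c"
  assumes "MoV_instance U V E C col l"
    and "complete_bipartite_graph U V E"
    and "n = card U" and "k = card V"
    and "bij_betw c {1..card C} C"
    and "\<forall>i\<in>{1..card C - 1}.
           card (color_class col U (c i)) \<ge> card (color_class col U (c (i + 1)))"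
  shows "(yes_instance U V E C col l \<longleftrightarrow>
            class_size U C col c 1 \<le> l * k + (\<Sum>i\<in>{1..k}. class_size U C col c (i + 1))) \<and>
         (yes_instance_nonempty U V E C col l \<longleftrightarrow>
            class_size U C col c 1 \<le> l * k + (\<Sum>i\<in>{1..k}. class_size U C col c (i + 1)) \<and>
            ((l > 0 \<and> n \<ge> k) \<or> (l = 0 \<and> n \<ge> 2 * k)))"
proof -
  have fin: "finite C" "finite U" "finite V" and colC: "col ` U \<subseteq> C"
    using assms(1) by (auto simp: MoV_instance_def bipartite_graph_def)
  let ?q = "if l = 0 then 2 else 1 :: nat"
  note cov = class_size_le_iff_covered[OF fin(1) assms(5,6)]
  note fair = fair_set_iff_covered[OF fin(1)]
  have yes: "yes_instance U V E C col l \<longleftrightarrow>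
      (\<exists>\<phi>. \<phi> ` U \<subseteq> V \<and> (\<forall>v\<in>V. covered C l 1 (counts col {u \<in> U. \<phi> u = v})))"
    using matching_iff_assignment[OF assms(2), of "fair_set C col l"]
    by (simp add: yes_instance_def fair_matching_def fair)
  have yes_ne: "yes_instance_nonempty U V E C col l \<longleftrightarrow>
      (\<exists>\<phi>. \<phi> ` U \<subseteq> V \<and> (\<forall>v\<in>V. covered C l 1 (counts col {u \<in> U. \<phi> u = v}) \<and>
        {u \<in> U. \<phi> u = v} \<noteq> {}))"
    using matching_iff_assignment[OF assms(2), of "\<lambda>W. fair_set C col l W \<and> W \<noteq> {}"]
    by (simp only: yes_instance_nonempty_def fair_matching_def fair ball_conj_distrib conj_assoc)
  have sumU: "sum (counts col U) C = n" using sum_counts fin colC assms(3) by blast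
  \<comment> \<open>The counts of \<open>U\<close> are the sum over the \<open>k\<close> fibers,
    each of which is 1-covered.\<close>
  have nec: "covered C l k (counts col U)"
    if "\<phi> ` U \<subseteq> V" "\<forall>v\<in>V. covered C l 1 (counts col {u \<in> U. \<phi> u = v})" for \<phi>
    unfolding counts_eq_sum_fibers[OF fin(2,3) that(1)] assms(4)
    using that(2) fin by (intro covered_sum) auto
  \<comment> \<open>For \<open>k = 0\<close> only the empty witness and the bound 0 are left, so all
    counts vanish and the assignment is trivial.\<close>
  have V_empty: "U = {}" if "V = {}" "covered C l k (counts col U)"
  proof -
    have "k = 0" using that(1) assms(4) by simp
    then have "\<forall>d\<in>C. counts col U d = 0"
      using that(2) fin(1) unfolding covered_def by (metis add_0 card_0_eq finite_Diff finite_subset le_zero_eq mult_0_right sum.empty)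
    then show ?thesis using sumU assms(3) fin(2) by simp
  qed
  have "yes_instance U V E C col l" if "covered C l k (counts col U)"
  proof (cases "V = {}")
    case True
    then show ?thesis unfolding yes using V_empty that by simp
  next
    case False
    then show ?thesis unfolding yes
      using assignment_of_splitting[of V U "covered C l" "covered C l 1" col]
        split_off_fair[OF fin(1)] fin that assms(4) by blast
  qed
  moreover have "yes_instance_nonempty U V E C col l"
    if "covered C l k (counts col U)" "?q * k \<le> n"
  proof (cases "V = {}")
    case True
    then show ?thesis unfolding yes_ne using V_empty that by simp
  next
    case False
    have "\<exists>\<phi>. \<phi> ` U \<subseteq> V \<and> (\<forall>v\<in>V. covered C l 1 (counts col {u \<in> U. \<phi> u = v}) \<and>
        0 < sum (counts col {u \<in> U. \<phi> u = v}) C)"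
    \<comment> \<open>Non-emptiness is expressed on count vectors as a positive total over
      \<open>C\<close>, and the size bound becomes part of the invariant.\<close>
    proof (rule assignment_of_splitting[where R = "\<lambda>k f. covered C l k f \<and> ?q * k \<le> sum f C"])
      show "covered C l (card V) (counts col U) \<and> ?q * card V \<le> sum (counts col U) C"
        using that sumU assms(4) by simp
      show "\<exists>g. (\<forall>c. g c \<le> f c) \<and> (covered C l 1 g \<and> 0 < sum g C) \<and>
          covered C l j (\<lambda>c. f c - g c) \<and> ?q * j \<le> (\<Sum>c\<in>C. f c - g c)"
        if "1 \<le> j" "covered C l (Suc j) f \<and> ?q * Suc j \<le> sum f C" for j f
        using split_off_fair_nonempty[OF fin(1)] that by blast
    qed (use False fin in \<open>auto split: if_splits\<close>)
    moreover have "W \<noteq> {}" if "0 < sum (counts col W) C" for W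
      using that by (auto simp: color_class_def)
    ultimately show ?thesis unfolding yes_ne by meson
  qed
  moreover have "?q * k \<le> n" if ne: "yes_instance_nonempty U V E C col l"
  proof -
    obtain \<phi> where \<phi>: "\<phi> ` U \<subseteq> V"
      "\<forall>v\<in>V. covered C l 1 (counts col {u \<in> U. \<phi> u = v}) \<and> {u \<in> U. \<phi> u = v} \<noteq> {}"
      using ne unfolding yes_ne by (elim exE conjE)
    \<comment> \<open>The fibers partition \<open>U\<close>, so a lower bound for each of the
      \<open>k\<close> fibers adds up to the bound on \<open>n\<close>.\<close>
    have "?q \<le> card {u \<in> U. \<phi> u = v}" if "v \<in> V" for v
    proof (cases "l = 0")
      case True
      then show ?thesis
        using covered_zero_card_ge_2[of "{u \<in> U. \<phi> u = v}" C col] bspec[OF \<phi>(2) that] fin colC by auto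
    next
      case False
      then show ?thesis using bspec[OF \<phi>(2) that] fin by (simp add: Suc_le_eq card_gt_0_iff)
    qed
    then have "(\<Sum>v\<in>V. ?q) \<le> (\<Sum>v\<in>V. card {u \<in> U. \<phi> u = v})" by (rule sum_mono)
    also have "\<dots> = n"
      using sum.group[OF fin(2,3) \<phi>(1), of "\<lambda>_. 1 :: nat"] assms(3) by simp
    finally show ?thesis using assms(4) by (simp add: mult.commute)
  qed
  moreover have "covered C l k (counts col U)" if "yes_instance U V E C col l"
    using nec that unfolding yes by blast
  moreover have "yes_instance U V E C col l" if "yes_instance_nonempty U V E C col l"
    using that unfolding yes yes_ne by blast
  moreover have "?q * k \<le> n \<longleftrightarrow> (l > 0 \<and> n \<ge> k) \<or> (l = 0 \<and> n \<ge> 2 * k)" by simp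
  ultimately show ?thesis unfolding cov by blast
qed

end
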